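(* Let $A$ be a unital complex Banach algebra, let $C$ be a connected component of $E_p(A)$, and let $a_0,a_1\in C$. Then there exists a polygonal path in $E_p(A)$ connecting $a_0$ and $a_1$.
   Context: All Banach algebras have a unit of norm $1$. Fix an integer $n\ge2$, distinct $\lambda_1,\dots,\lambda_n\in\mathbb C$, and let $p(\lambda)=\prod_{i=1}^n(\lambda-\lambda_i)$. For a unital complex Banach algebra $A$, $E_p(A)=\{a\in A\mid p(a)=0\}$, with the norm topology of $A$. A polygonal path in $E_p(A)$ is a concatenation of finitely many line segments each contained in $E_p(A)$. *)

theory Defs
  imports "HOL-Analysis.Analysis" "HOL-Computational_Algebra.Polynomial"
begin

text \<open>The library only has real Banach algebras. The class \<open>real_normed_algebra_1\<close> already demands
  \<open>norm 1 = 1\<close> and submultiplicativity of the norm, and \<open>banach\<close> demands completeness.\<close>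

class complex_banach_algebra_1 = real_normed_algebra_1 + banach +
  fixes scaleC :: "complex \<Rightarrow> 'a \<Rightarrow> 'a" (infixr "*\<^sub>C" 75)
  assumes scaleR_scaleC: "scaleR r x = complex_of_real r *\<^sub>C x"
    and scaleC_add_right: "c *\<^sub>C (x + y) = c *\<^sub>C x + c *\<^sub>C y"
    and scaleC_add_left: "(c + d) *\<^sub>C x = c *\<^sub>C x + d *\<^sub>C x"
    and scaleC_scaleC: "c *\<^sub>C d *\<^sub>C x = (c * d) *\<^sub>C x"
    and scaleC_one: "1 *\<^sub>C x = x"
    and mult_scaleC_left: "(c *\<^sub>C x) * y = c *\<^sub>C (x * y)"
    and mult_scaleC_right: "x * (c *\<^sub>C y) = c *\<^sub>C (x * y)"
    and norm_scaleC: "norm (c *\<^sub>C x) = cmod c * norm x"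

instantiation complex :: complex_banach_algebra_1
begin

definition scaleC_complex :: "complex \<Rightarrow> complex \<Rightarrow> complex"
  where "scaleC_complex c x = c * x"

instance
  by standard (simp_all add: scaleC_complex_def scaleR_conv_of_real algebra_simps norm_mult)

end

definition alg_poly :: "complex poly \<Rightarrow> 'a::complex_banach_algebra_1 \<Rightarrow> 'a"
  where "alg_poly p a = (\<Sum>k\<le>degree p. coeff p k *\<^sub>C a ^ k)"

definition E_set :: "complex poly \<Rightarrow> 'a::complex_banach_algebra_1 set"
  where "E_set p = {a. alg_poly p a = 0}"

definition root_poly :: "nat \<Rightarrow> (nat \<Rightarrow> complex) \<Rightarrow> complex poly"
  where "root_poly n l = (\<Prod>i=1..n. [:- l i, 1:])"

inductive polygonal_path_in :: "'a::real_normed_vector set \<Rightarrow> (real \<Rightarrow> 'a) \<Rightarrow> bool"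
  for S :: "'a set"
  where
    segment: "closed_segment a b \<subseteq> S \<Longrightarrow> polygonal_path_in S (linepath a b)"
  | join: "\<lbrakk>polygonal_path_in S g; closed_segment (pathfinish g) b \<subseteq> S\<rbrakk>
      \<Longrightarrow> polygonal_path_in S (g +++ linepath (pathfinish g) b)"

end

theory Submission
  imports Defs
begin

text \<open>
  Two elements of \<open>E\<^sub>p(A)\<close> that are close to each other are joined by a path of only two segments,
  and the rest is the usual argument that on a connected set a locally constant equivalence relation
  has one class.

  The local claim is modelled on the \<open>LU\<close> factorisation.  Interpolation yields polynomials \<open>Q\<^sub>k\<close>
  with \<open>Q\<^sub>k(\<lambda>\<^sub>i) = 1\<close> for \<open>i \<le> k\<close> and \<open>Q\<^sub>k(\<lambda>\<^sub>i) = 0\<close> for \<open>i > k\<close>.  For \<open>p(x) = 0\<close> the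
  elements \<open>Q\<^sub>k(x)\<close> form an increasing chain of idempotents from \<open>0\<close> to \<open>1\<close>: the flag of sums of
  spectral subspaces of \<open>x\<close>.  With respect to any chain \<open>q\<^sub>0 = 0, \<dots>, q\<^sub>n = 1\<close>, call \<open>x\<close> upper
  triangular with diagonal \<open>\<lambda>\<close> if \<open>x - \<lambda>\<^sub>k\<close> maps the \<open>k\<close>-th range into the one before it.  Then the
  factors of \<open>p(x)\<close> push the whole space down to zero one step at a time, so \<open>p(x) = 0\<close>; and since
  for a fixed chain this condition is affine in \<open>x\<close>, the segment between two such elements stays in
  \<open>E\<^sub>p(A)\<close> (lemma \<open>segment_in_E_set_upper\<close>).  Reversing the multiplication gives the same for lower
  triangular elements.

  Now let \<open>a\<close> and \<open>b\<close> be close, with chains \<open>q\<close> and \<open>f\<close>.  Then \<open>f\<^sub>k\<close> and \<open>q\<^sub>k\<close> are close, so there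
  is an idempotent \<open>r\<^sub>k\<close> with the range of \<open>f\<^sub>k\<close> and the kernel of \<open>q\<^sub>k\<close> (lemma
  \<open>oblique_idempotent\<close>).  These \<open>r\<^sub>k\<close> form a chain, and the element
  \<open>c = \<Sum>\<^sub>k \<lambda>\<^sub>k (r\<^sub>k - r\<^sub>k\<^sub>-\<^sub>1)\<close> is lower triangular for \<open>q\<close>, like \<open>a\<close>, and upper triangular for
  \<open>f\<close>, like \<open>b\<close>.  Hence the segments from \<open>a\<close> to \<open>c\<close> and from \<open>c\<close> to \<open>b\<close> lie in \<open>E\<^sub>p(A)\<close>.
\<close>

section \<open>Evaluating complex polynomials in a Banach algebra\<close>

lemma scaleC_zero_left [simp]: "0 *\<^sub>C x = (0::'a::complex_banach_algebra_1)"
  using scaleC_add_left[of 0 0 x] by simp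

lemma scaleC_zero_right [simp]: "c *\<^sub>C (0::'a::complex_banach_algebra_1) = 0"
  using scaleC_add_right[of c 0 0] by simp

lemma scaleC_minus_left: "(- c) *\<^sub>C x = - (c *\<^sub>C (x::'a::complex_banach_algebra_1))"
  using scaleC_add_left[of "- c" c x] by (simp add: eq_neg_iff_add_eq_0)

lemma scaleC_diff_right: "c *\<^sub>C (x - y) = c *\<^sub>C x - c *\<^sub>C (y::'a::complex_banach_algebra_1)"
  using scaleC_add_right[of c "x - y" y] by (simp add: algebra_simps)

lemma scaleC_sum_right:
  "c *\<^sub>C (\<Sum>i\<in>I. g i) = (\<Sum>i\<in>I. c *\<^sub>C (g i :: 'a::complex_banach_algebra_1))"
  by (induction I rule: infinite_finite_induct) (simp_all add: scaleC_add_right)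

lemma continuous_on_scaleC:
  fixes f :: "'b::topological_space \<Rightarrow> 'a::complex_banach_algebra_1"
  assumes "continuous_on S f"
  shows "continuous_on S (\<lambda>x. c *\<^sub>C f x)"
proof -
  have "bounded_linear (\<lambda>x::'a. c *\<^sub>C x)"
    by (rule bounded_linear_intro[where K = "cmod c"])
       (simp_all add: scaleC_add_right scaleR_scaleC scaleC_scaleC norm_scaleC mult.commute)
  then show ?thesis
    using assms by (rule bounded_linear.continuous_on)
qed

lemma alg_poly_bound:
  assumes "degree p \<le> m"
  shows "alg_poly p a = (\<Sum>k\<le>m. coeff p k *\<^sub>C a ^ k)"
  unfolding alg_poly_def
  by (rule sum.mono_neutral_left) (use assms in \<open>auto simp: coeff_eq_0 not_le\<close>)

lemma alg_poly_0 [simp]: "alg_poly 0 a = 0"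
  by (simp add: alg_poly_def)

lemma alg_poly_pCons: "alg_poly (pCons c p) a = c *\<^sub>C 1 + a * alg_poly p a"
proof -
  have "alg_poly (pCons c p) a = (\<Sum>k\<le>Suc (degree p). coeff (pCons c p) k *\<^sub>C a ^ k)"
    by (rule alg_poly_bound) (rule degree_pCons_le)
  also have "\<dots> = c *\<^sub>C 1 + (\<Sum>k\<le>degree p. coeff p k *\<^sub>C a ^ Suc k)"
    by (subst sum.atMost_Suc_shift) simp
  finally show ?thesis
    by (simp add: alg_poly_def sum_distrib_left mult_scaleC_right)
qed

lemma alg_poly_1 [simp]: "alg_poly 1 a = 1"
  by (simp add: one_pCons alg_poly_pCons scaleC_one)

lemma alg_poly_linear: "alg_poly [:- c, 1:] a = a - c *\<^sub>C 1"
  by (simp add: alg_poly_pCons scaleC_one scaleC_minus_left)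

lemma alg_poly_add: "alg_poly (p + q) a = alg_poly p a + alg_poly q a"
proof -
  define m where "m = max (degree p) (degree q)"
  have "degree (p + q) \<le> m" "degree p \<le> m" "degree q \<le> m"
    by (auto simp: m_def degree_add_le)
  then show ?thesis
    by (simp add: alg_poly_bound[of _ m] sum.distrib scaleC_add_left)
qed

lemma alg_poly_smult: "alg_poly (smult c p) a = c *\<^sub>C alg_poly p a"
  by (simp add: alg_poly_bound[OF degree_smult_le] alg_poly_def scaleC_sum_right scaleC_scaleC)

lemma alg_poly_mult: "alg_poly (p * q) a = alg_poly p a * alg_poly q a"
proof (induction p)
  case 0
  then show ?case by simp
next
  case (pCons c p)
  then show ?case
    by (simp add: mult_pCons_left alg_poly_add alg_poly_smult alg_poly_pCons distrib_right
        mult_scaleC_left mult.assoc)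
qed

lemma alg_poly_diff: "alg_poly (p - q) a = alg_poly p a - alg_poly q a"
  using alg_poly_add[of "p - q" q a] by simp

lemma continuous_on_alg_poly: "continuous_on S (alg_poly p)"
  unfolding alg_poly_def by (intro continuous_intros continuous_on_scaleC)

section \<open>Interpolation and the functional calculus on the zero set\<close>

lemma root_poly_0 [simp]: "root_poly 0 l = 1"
  by (simp add: root_poly_def)

lemma root_poly_Suc: "root_poly (Suc n) l = root_poly n l * [:- l (Suc n), 1:]"
  by (simp add: root_poly_def)

lemma poly_root_poly_eq_0_iff: "poly (root_poly n l) z = 0 \<longleftrightarrow> (\<exists>i\<in>{1..n}. z = l i)"
  by (auto simp: root_poly_def poly_prod)

lemma poly_root_poly_Suc_neq_0:
  assumes "inj_on l {1..Suc n}"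
  shows "poly (root_poly n l) (l (Suc n)) \<noteq> 0"
proof
  assume "poly (root_poly n l) (l (Suc n)) = 0"
  then obtain i where "i \<in> {1..n}" "l (Suc n) = l i"
    unfolding poly_root_poly_eq_0_iff by blast
  then show False
    using inj_onD[OF assms, of "Suc n" i] by simp
qed

lemma interpolation_exists:
  fixes l :: "nat \<Rightarrow> complex"
  assumes "inj_on l {1..n}"
  shows "\<exists>Q. \<forall>i\<in>{1..n}. poly Q (l i) = (g i :: complex)"
  using assms
proof (induction n)
  case 0
  then show ?case by simp
next
  case (Suc n)
  have "inj_on l {1..n}"
    by (rule inj_on_subset[OF Suc.prems]) simp
  then obtain Q where Q: "\<forall>i\<in>{1..n}. poly Q (l i) = g i"
    using Suc.IH by blast
  have nz: "poly (root_poly n l) (l (Suc n)) \<noteq> 0"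
    using Suc.prems by (rule poly_root_poly_Suc_neq_0)
  have z: "poly (root_poly n l) (l i) = 0" if "i \<in> {1..n}" for i
    using that by (auto simp: poly_root_poly_eq_0_iff)
  define c where "c = (g (Suc n) - poly Q (l (Suc n))) / poly (root_poly n l) (l (Suc n))"
  have "poly (Q + smult c (root_poly n l)) (l i) = g i" if "i \<in> {1..Suc n}" for i
    using that nz z Q by (cases "i = Suc n") (auto simp: c_def)
  then show ?case by blast
qed

lemma root_poly_dvd:
  assumes "inj_on l {1..n}" and "\<forall>i\<in>{1..n}. poly Q (l i) = 0"
  shows "root_poly n l dvd Q"
  using assms
proof (induction n)
  case 0
  then show ?case by simp
next
  case (Suc n)
  have "inj_on l {1..n}"
    by (rule inj_on_subset[OF Suc.prems(1)]) simp
  then have "root_poly n l dvd Q"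
    using Suc.IH Suc.prems(2) by simp
  then obtain R where R: "Q = root_poly n l * R" ..
  have "poly R (l (Suc n)) = 0"
    using Suc.prems(2) poly_root_poly_Suc_neq_0[OF Suc.prems(1)] R by auto
  then show ?case
    unfolding R root_poly_Suc poly_eq_0_iff_dvd by (rule mult_dvd_mono[OF dvd_refl])
qed

text \<open>On the zero set of \<open>p\<close> the functional calculus factors through \<open>\<complex>[\<lambda>]/(p)\<close>, hence through
  the values at the roots: identities between spectral idempotents reduce to scalar ones.\<close>

lemma alg_poly_cong_roots:
  assumes "inj_on l {1..n}" and "x \<in> E_set (root_poly n l)"
    and "\<And>i. i \<in> {1..n} \<Longrightarrow> poly P (l i) = poly Q (l i)"
  shows "alg_poly P x = alg_poly Q x"
proof -
  have "root_poly n l dvd P - Q"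
    using assms by (intro root_poly_dvd) auto
  then obtain R where R: "P - Q = root_poly n l * R" ..
  have "alg_poly P x - alg_poly Q x = alg_poly (root_poly n l) x * alg_poly R x"
    unfolding alg_poly_diff[symmetric] R alg_poly_mult ..
  also have "\<dots> = 0"
    using assms(2) by (simp add: E_set_def)
  finally show ?thesis by simp
qed

section \<open>Triangular elements\<close>

definition upper_triangular ::
    "(nat \<Rightarrow> complex) \<Rightarrow> nat \<Rightarrow> (nat \<Rightarrow> 'a::complex_banach_algebra_1) \<Rightarrow> 'a \<Rightarrow> bool" where
  "upper_triangular l n q x \<longleftrightarrow>
     (\<forall>k<n. (x - l (Suc k) *\<^sub>C 1) * q (Suc k) = q k * ((x - l (Suc k) *\<^sub>C 1) * q (Suc k)))"

definition lower_triangular ::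
    "(nat \<Rightarrow> complex) \<Rightarrow> nat \<Rightarrow> (nat \<Rightarrow> 'a::complex_banach_algebra_1) \<Rightarrow> 'a \<Rightarrow> bool" where
  "lower_triangular l n q x \<longleftrightarrow>
     (\<forall>k<n. q (Suc k) * (x - l (Suc k) *\<^sub>C 1) = q (Suc k) * (x - l (Suc k) *\<^sub>C 1) * q k)"

text \<open>The factor \<open>x - \<lambda>\<^sub>k\<close> moves the range of \<open>q\<^sub>k\<close> into that of \<open>q\<^sub>k\<^sub>-\<^sub>1\<close>, so by induction the
  first \<open>k\<close> factors of \<open>p(x)\<close> annihilate the range of \<open>q\<^sub>k\<close>.\<close>

lemma upper_triangular_in_E_set:
  assumes "upper_triangular l n q x" and "q 0 = 0" and "q n = 1"
  shows "x \<in> E_set (root_poly n l)"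
proof -
  have "alg_poly (root_poly k l) x * q k = 0" if "k \<le> n" for k
    using that
  proof (induction k)
    case 0
    then show ?case by (simp add: assms)
  next
    case (Suc k)
    let ?y = "(x - l (Suc k) *\<^sub>C 1) * q (Suc k)"
    have "alg_poly (root_poly (Suc k) l) x * q (Suc k) = alg_poly (root_poly k l) x * ?y"
      by (simp only: root_poly_Suc alg_poly_mult alg_poly_linear mult.assoc)
    also have "\<dots> = alg_poly (root_poly k l) x * q k * ?y"
      using assms(1) Suc.prems by (metis Suc_le_eq mult.assoc upper_triangular_def)
    finally show ?case
      using Suc by simp
  qed
  from this[of n] show ?thesis
    by (simp add: E_set_def assms)
qed

lemma lower_triangular_in_E_set:
  assumes "lower_triangular l n q x" and "q 0 = 0" and "q n = 1"
  shows "x \<in> E_set (root_poly n l)"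
proof -
  have "q k * alg_poly (root_poly k l) x = 0" if "k \<le> n" for k
    using that
  proof (induction k)
    case 0
    then show ?case by (simp add: assms)
  next
    case (Suc k)
    let ?y = "q (Suc k) * (x - l (Suc k) *\<^sub>C 1)"
    have "root_poly (Suc k) l = [:- l (Suc k), 1:] * root_poly k l"
      by (simp only: root_poly_Suc mult.commute)
    then have "q (Suc k) * alg_poly (root_poly (Suc k) l) x = ?y * alg_poly (root_poly k l) x"
      by (simp only: alg_poly_mult alg_poly_linear mult.assoc)
    also have "\<dots> = ?y * (q k * alg_poly (root_poly k l) x)"
      using assms(1) Suc.prems by (metis Suc_le_eq mult.assoc lower_triangular_def)
    finally show ?case
      using Suc by simp
  qed
  from this[of n] show ?thesis
    by (simp add: E_set_def assms)
qed

lemma convex_upper_triangular: "convex {x. upper_triangular l n q x}"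
proof (rule convexI)
  fix x y :: 'a and u v :: real
  assume xy: "x \<in> {x. upper_triangular l n q x}" "y \<in> {x. upper_triangular l n q x}"
    and uv: "0 \<le> u" "0 \<le> v" "u + v = 1"
  have "(u *\<^sub>R x + v *\<^sub>R y - l (Suc k) *\<^sub>C 1) * q (Suc k)
      = q k * ((u *\<^sub>R x + v *\<^sub>R y - l (Suc k) *\<^sub>C 1) * q (Suc k))" if "k < n" for k
  proof -
    let ?d = "\<lambda>z. (z - l (Suc k) *\<^sub>C 1) * q (Suc k)"
    have "l (Suc k) *\<^sub>C (1::'a) = u *\<^sub>R (l (Suc k) *\<^sub>C 1) + v *\<^sub>R (l (Suc k) *\<^sub>C 1)"
      by (metis scaleR_left_distrib scaleR_one uv(3))
    then have "u *\<^sub>R x + v *\<^sub>R y - l (Suc k) *\<^sub>C 1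
        = u *\<^sub>R (x - l (Suc k) *\<^sub>C 1) + v *\<^sub>R (y - l (Suc k) *\<^sub>C 1)"
      by (metis add_diff_add scaleR_diff_right)
    then have comb: "?d (u *\<^sub>R x + v *\<^sub>R y) = u *\<^sub>R ?d x + v *\<^sub>R ?d y"
      by (simp add: distrib_right)
    have "?d x = q k * ?d x" "?d y = q k * ?d y"
      using xy that unfolding upper_triangular_def by blast+
    then show ?thesis
      unfolding comb by (metis distrib_left mult_scaleR_right)
  qed
  then show "u *\<^sub>R x + v *\<^sub>R y \<in> {x. upper_triangular l n q x}"
    by (simp add: upper_triangular_def)
qed

lemma convex_lower_triangular: "convex {x. lower_triangular l n q x}"
proof (rule convexI)
  fix x y :: 'a and u v :: real
  assume xy: "x \<in> {x. lower_triangular l n q x}" "y \<in> {x. lower_triangular l n q x}"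
    and uv: "0 \<le> u" "0 \<le> v" "u + v = 1"
  have "q (Suc k) * (u *\<^sub>R x + v *\<^sub>R y - l (Suc k) *\<^sub>C 1)
      = q (Suc k) * (u *\<^sub>R x + v *\<^sub>R y - l (Suc k) *\<^sub>C 1) * q k" if "k < n" for k
  proof -
    let ?d = "\<lambda>z. q (Suc k) * (z - l (Suc k) *\<^sub>C 1)"
    have "l (Suc k) *\<^sub>C (1::'a) = u *\<^sub>R (l (Suc k) *\<^sub>C 1) + v *\<^sub>R (l (Suc k) *\<^sub>C 1)"
      by (metis scaleR_left_distrib scaleR_one uv(3))
    then have "u *\<^sub>R x + v *\<^sub>R y - l (Suc k) *\<^sub>C 1
        = u *\<^sub>R (x - l (Suc k) *\<^sub>C 1) + v *\<^sub>R (y - l (Suc k) *\<^sub>C 1)"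
      by (metis add_diff_add scaleR_diff_right)
    then have comb: "?d (u *\<^sub>R x + v *\<^sub>R y) = u *\<^sub>R ?d x + v *\<^sub>R ?d y"
      by (simp add: distrib_left)
    have "?d x = ?d x * q k" "?d y = ?d y * q k"
      using xy that unfolding lower_triangular_def by blast+
    then show ?thesis
      unfolding comb by (metis distrib_right mult_scaleR_left)
  qed
  then show "u *\<^sub>R x + v *\<^sub>R y \<in> {x. lower_triangular l n q x}"
    by (simp add: lower_triangular_def)
qed

lemma segment_in_E_set_upper:
  assumes "upper_triangular l n q x" "upper_triangular l n q y" "q 0 = 0" "q n = 1"
  shows "closed_segment x y \<subseteq> E_set (root_poly n l)"
proof
  fix z assume "z \<in> closed_segment x y"
  moreover have "closed_segment x y \<subseteq> {x. upper_triangular l n q x}"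
    by (rule closed_segment_subset[OF _ _ convex_upper_triangular]) (simp_all add: assms)
  ultimately show "z \<in> E_set (root_poly n l)"
    using upper_triangular_in_E_set assms(3,4) by blast
qed

lemma segment_in_E_set_lower:
  assumes "lower_triangular l n q x" "lower_triangular l n q y" "q 0 = 0" "q n = 1"
  shows "closed_segment x y \<subseteq> E_set (root_poly n l)"
proof
  fix z assume "z \<in> closed_segment x y"
  moreover have "closed_segment x y \<subseteq> {x. lower_triangular l n q x}"
    by (rule closed_segment_subset[OF _ _ convex_lower_triangular]) (simp_all add: assms)
  ultimately show "z \<in> E_set (root_poly n l)"
    using lower_triangular_in_E_set assms(3,4) by blast
qed

section \<open>The spectral flag\<close>

text \<open>The existence of these polynomials is what the distinctness of the \<open>\<lambda>\<^sub>i\<close> gives.  They are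
  chosen once for all \<open>x\<close>, so that the idempotents depend continuously on \<open>x\<close>.\<close>

lemma flag_polynomials_exist:
  fixes l :: "nat \<Rightarrow> complex"
  assumes "inj_on l {1..n}"
  shows "\<exists>Q. \<forall>k. \<forall>i\<in>{1..n}. poly (Q k) (l i) = (if i \<le> k then 1 else 0 :: complex)"
  by (intro choice allI) (rule interpolation_exists[OF assms])

locale spectral_flag =
  fixes n :: nat and l :: "nat \<Rightarrow> complex" and Q :: "nat \<Rightarrow> complex poly"
  assumes distinct_roots: "inj_on l {1..n}"
    and flag_values: "i \<in> {1..n} \<Longrightarrow> poly (Q k) (l i) = (if i \<le> k then 1 else 0)"
begin

lemma flag_0:
  assumes "x \<in> E_set (root_poly n l)"
  shows "alg_poly (Q 0) x = 0"
proof -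
  have "alg_poly (Q 0) x = alg_poly 0 x"
    by (rule alg_poly_cong_roots[OF distinct_roots assms]) (simp add: flag_values)
  then show ?thesis by simp
qed

lemma flag_top:
  assumes "x \<in> E_set (root_poly n l)"
  shows "alg_poly (Q n) x = 1"
proof -
  have "alg_poly (Q n) x = alg_poly 1 x"
    by (rule alg_poly_cong_roots[OF distinct_roots assms]) (simp add: flag_values)
  then show ?thesis by simp
qed

lemma flag_mult:
  assumes "x \<in> E_set (root_poly n l)"
  shows "alg_poly (Q j) x * alg_poly (Q k) x = alg_poly (Q (min j k)) x"
  unfolding alg_poly_mult[symmetric]
  by (rule alg_poly_cong_roots[OF distinct_roots assms]) (simp add: flag_values)

text \<open>At the root \<open>\<lambda>\<^sub>i\<close> the polynomial \<open>(\<lambda> - \<lambda>\<^sub>k\<^sub>+\<^sub>1) Q\<^sub>k\<^sub>+\<^sub>1\<close> vanishes unless \<open>i \<le> k\<close>, and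
  exactly there \<open>Q\<^sub>k\<close> has the value \<open>1\<close>.\<close>

lemma flag_annihilation:
  "i \<in> {1..n} \<Longrightarrow>
     poly ([:- l (Suc k), 1:] * Q (Suc k)) (l i) =
     poly (Q k * ([:- l (Suc k), 1:] * Q (Suc k))) (l i)"
  unfolding poly_mult by (cases "i = Suc k") (simp_all add: flag_values)

lemma flag_upper_triangular:
  assumes "x \<in> E_set (root_poly n l)"
  shows "upper_triangular l n (\<lambda>k. alg_poly (Q k) x) x"
  unfolding upper_triangular_def
proof (intro allI impI)
  fix k
  from alg_poly_cong_roots[OF distinct_roots assms flag_annihilation[of _ k]]
  show "(x - l (Suc k) *\<^sub>C 1) * alg_poly (Q (Suc k)) x =
      alg_poly (Q k) x * ((x - l (Suc k) *\<^sub>C 1) * alg_poly (Q (Suc k)) x)"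
    unfolding alg_poly_mult alg_poly_linear .
qed

lemma flag_lower_triangular:
  assumes "x \<in> E_set (root_poly n l)"
  shows "lower_triangular l n (\<lambda>k. alg_poly (Q k) x) x"
  unfolding lower_triangular_def
proof (intro allI impI)
  fix k
  let ?L = "[:- l (Suc k), 1:]"
  have "poly (Q (Suc k) * ?L) (l i) = poly (Q (Suc k) * ?L * Q k) (l i)" if "i \<in> {1..n}" for i
    using flag_annihilation[OF that, of k] by (simp only: poly_mult mult.assoc mult.commute)
  from alg_poly_cong_roots[OF distinct_roots assms this]
  show "alg_poly (Q (Suc k)) x * (x - l (Suc k) *\<^sub>C 1) =
      alg_poly (Q (Suc k)) x * (x - l (Suc k) *\<^sub>C 1) * alg_poly (Q k) x"
    unfolding alg_poly_mult alg_poly_linear .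
qed

end

section \<open>Oblique idempotents\<close>

lemma invertible_one_minus:
  fixes x :: "'a::{real_normed_algebra_1,banach}"
  assumes "norm x < 1"
  shows "\<exists>y. (1 - x) * y = 1 \<and> y * (1 - x) = 1"
proof -
  have s: "summable (\<lambda>k. x ^ k)"
    using assms by (rule complete_algebra_summable_geometric)
  let ?y = "\<Sum>k. x ^ k"
  have "?y = 1 + (\<Sum>k. x ^ Suc k)"
    using suminf_split_head[OF s] by simp
  moreover have "(\<Sum>k. x ^ Suc k) = x * ?y"
    using suminf_mult[OF s, of x] by simp
  moreover have "(\<Sum>k. x ^ Suc k) = ?y * x"
    using suminf_mult2[OF s, of x] by (simp add: power_commutes)
  ultimately have "(1 - x) * ?y = 1" "?y * (1 - x) = 1"
    by (simp_all add: algebra_simps)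
  then show ?thesis by blast
qed

text \<open>The four equations say that \<open>r\<close> is the projection onto the range of \<open>f\<close> along the kernel of
  \<open>q\<close>.  With \<open>d = f - (1 - q)\<close> it is \<open>r = f d\<^sup>-\<^sup>1\<close>, the classical formula for an oblique
  projection in terms of the two idempotents \<open>f\<close> and \<open>1 - q\<close> whose ranges are complementary;
  \<open>d\<close> is invertible because \<open>d\<^sup>2 = 1 - (f - q)\<^sup>2\<close>.\<close>

lemma oblique_idempotent:
  fixes f q :: "'a::{real_normed_algebra_1,banach}"
  assumes f: "f * f = f" and q: "q * q = q" and close: "norm (f - q) < 1"
  shows "\<exists>r. f * r = r \<and> r * f = f \<and> r * q = r \<and> q * r = q"
proof -
  define d where "d = f + q - 1"
  have "norm ((f - q) * (f - q)) \<le> norm (f - q) * norm (f - q)"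
    by (rule norm_mult_ineq)
  also have "\<dots> < 1"
    using mult_strict_mono'[OF close close] by simp
  finally obtain y where y: "(1 - (f - q) * (f - q)) * y = 1" "y * (1 - (f - q) * (f - q)) = 1"
    using invertible_one_minus by blast
  have dd: "1 - (f - q) * (f - q) = d * d"
    by (simp add: d_def algebra_simps f q)
  have "d * (d * y) = 1" "(y * d) * d = 1"
    using y unfolding dd by (simp_all add: mult.assoc)
  \<comment> \<open>The right inverse \<open>d * y\<close> and the left inverse \<open>y * d\<close> of \<open>d\<close> agree.\<close>
  then have right: "d * (d * y) = 1" and left: "(d * y) * d = 1"
    by (metis mult.assoc mult.left_neutral mult.right_neutral)+
  define e where "e = d * y"
  have inv: "d * e = 1" "e * d = 1"
    using left right by (simp_all add: e_def)
  have "f * d = f * q" "d * q = f * q" "q * d = q * f" "d * f = q * f"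
    by (simp_all add: d_def algebra_simps f q)
  then have comm: "f * d = d * q" "q * d = d * f" and fq: "f * d = f * q" "q * d = q * f"
    by simp_all
  have fe: "f * e = e * q"
    by (metis comm(2) inv mult.assoc mult.left_neutral mult.right_neutral)
  have 1: "f * (f * e) = f * e" "f * e * q = f * e"
    by (metis f mult.assoc) (metis fe q mult.assoc)
  have 2: "f * e * f = f"
    by (metis comm(2) fe fq(2) inv(2) mult.assoc mult.left_neutral)
  have 3: "q * (f * e) = q"
    by (metis fq(2) inv(1) mult.assoc mult.right_neutral)
  show ?thesis
    using 1 2 3 by blast
qed

section \<open>Nearby elements are joined by two segments\<close>

text \<open>The spectral idempotents of the element sought are the differences of consecutive members of
  the oblique chain \<open>r\<close>.  Being triangular with respect to \<open>r\<close>, the element is upper triangular for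
  every chain with the same ranges and lower triangular for every chain with the same kernels.\<close>

lemma triangular_for_both_flags:
  fixes f q r :: "nat \<Rightarrow> 'a::complex_banach_algebra_1"
  assumes f_chain: "\<And>j k. f j * f k = f (min j k)" and q_chain: "\<And>j k. q j * q k = q (min j k)"
    and f0: "f 0 = 0"
    and fr: "\<And>k. k \<le> n \<Longrightarrow> f k * r k = r k" and rf: "\<And>k. k \<le> n \<Longrightarrow> r k * f k = f k"
    and rq: "\<And>k. k \<le> n \<Longrightarrow> r k * q k = r k" and qr: "\<And>k. k \<le> n \<Longrightarrow> q k * r k = q k"
  shows "\<exists>c. upper_triangular l n f c \<and> lower_triangular l n q c"
proof -
  have r0: "r 0 = 0"
    using fr[of 0] f0 by simp
  have r_up: "r j * r k = r j" if "j \<le> k" "k \<le> n" for j k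
  proof -
    have "r j * r k = r j * (q j * q k) * r k"
      using that rq[of j] q_chain[of j k] by (simp add: min_absorb1)
    also have "\<dots> = r j * (q j * q k)"
      using that qr[of k] by (simp add: mult.assoc)
    finally show ?thesis
      using that rq[of j] q_chain[of j k] by (simp add: min_absorb1)
  qed
  have r_down: "r k * r j = r j" if "j \<le> k" "k \<le> n" for j k
  proof -
    have "r k * r j = r k * (f k * f j) * r j"
      using that fr[of j] f_chain[of k j] by (simp add: min_absorb2 mult.assoc)
    also have "\<dots> = f k * f j * r j"
      using that rf[of k] by (simp add: mult.assoc[symmetric])
    finally show ?thesis
      using that fr[of j] f_chain[of k j] by (simp add: min_absorb2)
  qed
  define s where "s k = (\<Sum>i<k. l (Suc i) *\<^sub>C (r (Suc i) - r i))" for k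
  have s_r: "s m * r k = s (min m k)" if "m \<le> n" "k \<le> n" for m k
    using that
  proof (induction m)
    case 0
    then show ?case by (simp add: s_def)
  next
    case (Suc m)
    have "(r (Suc m) - r m) * r k = (if Suc m \<le> k then r (Suc m) - r m else 0)"
      using Suc.prems by (auto simp: left_diff_distrib r_up r_down not_less_eq_eq)
    then show ?case
      using Suc by (auto simp: s_def distrib_right mult_scaleC_left min_def not_less_eq_eq le_antisym)
  qed
  have r_s: "r k * s m = s (min m k)" if "m \<le> n" "k \<le> n" for m k
    using that
  proof (induction m)
    case 0
    then show ?case by (simp add: s_def)
  next
    case (Suc m)
    have "r k * (r (Suc m) - r m) = (if Suc m \<le> k then r (Suc m) - r m else 0)"
      using Suc.prems by (auto simp: right_diff_distrib r_up r_down not_less_eq_eq)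
    then show ?case
      using Suc by (auto simp: s_def distrib_left mult_scaleC_right min_def not_less_eq_eq le_antisym)
  qed
  \<comment> \<open>On the block \<open>r (Suc k) - r k\<close> the element \<open>s n\<close> is the scalar \<open>l (Suc k)\<close>; subtracting it
     leaves an element of the corner \<open>r k * A * r k\<close>, on either side.\<close>
  have step: "s (Suc k) - l (Suc k) *\<^sub>C r (Suc k) = s k - l (Suc k) *\<^sub>C r k" for k
    by (simp add: s_def scaleC_diff_right)
  have right: "(s n - l (Suc k) *\<^sub>C 1) * r (Suc k) = s k - l (Suc k) *\<^sub>C r k"
    and left: "r (Suc k) * (s n - l (Suc k) *\<^sub>C 1) = s k - l (Suc k) *\<^sub>C r k" if "k < n" for k
    using that step[of k]
    by (simp_all add: left_diff_distrib right_diff_distrib s_r r_s mult_scaleC_left mult_scaleC_right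
        min_absorb2)
  have fix_left: "r k * (s k - l (Suc k) *\<^sub>C r k) = s k - l (Suc k) *\<^sub>C r k"
    and fix_right: "(s k - l (Suc k) *\<^sub>C r k) * r k = s k - l (Suc k) *\<^sub>C r k" if "k < n" for k
    using that
    by (simp_all add: left_diff_distrib right_diff_distrib s_r r_s r_up mult_scaleC_left
        mult_scaleC_right)
  have "upper_triangular l n f (s n)"
    unfolding upper_triangular_def
  proof (intro allI impI)
    fix k assume k: "k < n"
    let ?t = "s k - l (Suc k) *\<^sub>C r k"
    have "(s n - l (Suc k) *\<^sub>C 1) * f (Suc k) = ?t * f (Suc k)"
      using rf[of "Suc k"] right[OF k] k by (metis Suc_leI mult.assoc)
    moreover have "f k * ?t = ?t"
      using fr[of k] fix_left[OF k] k by (metis less_imp_le mult.assoc)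
    ultimately show "(s n - l (Suc k) *\<^sub>C 1) * f (Suc k) =
        f k * ((s n - l (Suc k) *\<^sub>C 1) * f (Suc k))"
      by (metis mult.assoc)
  qed
  moreover have "lower_triangular l n q (s n)"
    unfolding lower_triangular_def
  proof (intro allI impI)
    fix k assume k: "k < n"
    let ?t = "s k - l (Suc k) *\<^sub>C r k"
    have "q (Suc k) * (s n - l (Suc k) *\<^sub>C 1) = q (Suc k) * ?t"
      using qr[of "Suc k"] left[OF k] k by (metis Suc_leI mult.assoc)
    moreover have "?t * q k = ?t"
      using rq[of k] fix_right[OF k] k by (metis less_imp_le mult.assoc)
    ultimately show "q (Suc k) * (s n - l (Suc k) *\<^sub>C 1) =
        q (Suc k) * (s n - l (Suc k) *\<^sub>C 1) * q k"
      by (metis mult.assoc)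
  qed
  ultimately show ?thesis by blast
qed

lemma (in spectral_flag) nearby_joined_by_two_segments:
  fixes a :: "'a::complex_banach_algebra_1"
  assumes a: "a \<in> E_set (root_poly n l)"
  shows "\<exists>U. open U \<and> a \<in> U \<and> (\<forall>b \<in> U \<inter> E_set (root_poly n l). \<exists>c.
           closed_segment a c \<subseteq> E_set (root_poly n l) \<and>
           closed_segment c b \<subseteq> E_set (root_poly n l))"
proof -
  define q where "q k = alg_poly (Q k) a" for k
  define U where "U = (\<Inter>k\<le>n. {x. norm (alg_poly (Q k) x - q k) < 1})"
  have "open {x. norm (alg_poly (Q k) x - q k) < 1}" for k
    by (intro open_Collect_less continuous_intros continuous_on_alg_poly)
  then have "open U"
    unfolding U_def by blast
  moreover have "a \<in> U"
    by (simp add: U_def q_def)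
  moreover have "\<exists>c. closed_segment a c \<subseteq> E_set (root_poly n l) \<and>
      closed_segment c b \<subseteq> E_set (root_poly n l)"
    if bU: "b \<in> U" and b: "b \<in> E_set (root_poly n l)" for b
  proof -
    define f where "f k = alg_poly (Q k) b" for k
    have f_chain: "f j * f k = f (min j k)" and q_chain: "q j * q k = q (min j k)" for j k
      using flag_mult a b by (simp_all add: f_def q_def)
    have ends: "f 0 = 0" "f n = 1" "q 0 = 0" "q n = 1"
      using flag_0 flag_top a b by (simp_all add: f_def q_def)
    have "\<exists>r. f k * r = r \<and> r * f k = f k \<and> r * q k = r \<and> q k * r = q k" if "k \<le> n" for k
    proof (rule oblique_idempotent)
      show "norm (f k - q k) < 1"
        using bU that by (simp add: U_def f_def)
    qed (simp_all add: f_chain q_chain)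
    then obtain r where "\<And>k. k \<le> n \<Longrightarrow>
        f k * r k = r k \<and> r k * f k = f k \<and> r k * q k = r k \<and> q k * r k = q k"
      by metis
    then obtain c where c: "upper_triangular l n f c" "lower_triangular l n q c"
      using triangular_for_both_flags[OF f_chain q_chain ends(1), of n r l] by blast
    have "lower_triangular l n q a" "upper_triangular l n f b"
      using flag_lower_triangular[OF a] flag_upper_triangular[OF b]
      by (simp_all add: f_def[abs_def] q_def[abs_def])
    then show ?thesis
      using segment_in_E_set_lower segment_in_E_set_upper c ends by blast
  qed
  ultimately show ?thesis by blast
qed

section \<open>Polygonal paths in a connected component\<close>

lemma polygonal_path_if_segment_chain:
  assumes "(\<lambda>x y. closed_segment x y \<subseteq> S)\<^sup>*\<^sup>* a b" and "a \<in> S"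
  shows "\<exists>g. polygonal_path_in S g \<and> pathstart g = a \<and> pathfinish g = b"
  using assms(1)
proof (induction rule: rtranclp_induct)
  case base
  have "polygonal_path_in S (linepath a a)"
    by (rule polygonal_path_in.segment) (simp add: assms(2))
  then show ?case
    using pathstart_linepath pathfinish_linepath by blast
next
  case (step x y)
  then obtain g where g: "polygonal_path_in S g" "pathstart g = a" "pathfinish g = x" by blast
  then have "polygonal_path_in S (g +++ linepath (pathfinish g) y)"
    using step.hyps(2) by (intro polygonal_path_in.join) simp_all
  then show ?case
    using g(2) by (intro exI[of _ "g +++ linepath (pathfinish g) y"]) simp
qed

theorem theorem16:
  fixes n :: nat and l :: "nat \<Rightarrow> complex"
    and C :: "'a::complex_banach_algebra_1 set" and a0 a1 :: 'a
  assumes "n \<ge> 2"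
    and "inj_on l {1..n}"
    and "C \<in> components (E_set (root_poly n l))"
    and "a0 \<in> C" and "a1 \<in> C"
  shows "\<exists>g. polygonal_path_in (E_set (root_poly n l)) g
           \<and> pathstart g = a0 \<and> pathfinish g = a1"
proof -
  let ?E = "E_set (root_poly n l) :: 'a set"
  define seg where "seg = (\<lambda>x y. closed_segment x y \<subseteq> ?E)"
  obtain Q where "\<forall>k. \<forall>i\<in>{1..n}. poly (Q k) (l i) = (if i \<le> k then 1 else 0)"
    using flag_polynomials_exist[OF assms(2)] by blast
  then interpret spectral_flag n l Q
    by unfold_locales (use assms(2) in auto)
  have CE: "C \<subseteq> ?E"
    using assms(3) by (rule in_components_subset)
  have "symp seg"
    by (auto simp: seg_def symp_def closed_segment_commute)
  then have sym: "symp seg\<^sup>*\<^sup>*"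
    by (rule symp_rtranclp)
  have "seg\<^sup>*\<^sup>* a0 a1"
  proof (rule connected_equivalence_relation[OF in_components_connected[OF assms(3)] assms(4,5)])
    show "seg\<^sup>*\<^sup>* y x" if "seg\<^sup>*\<^sup>* x y" for x y
      using sym that by (rule sympD)
    show "seg\<^sup>*\<^sup>* x z" if "seg\<^sup>*\<^sup>* x y" "seg\<^sup>*\<^sup>* y z" for x y z
      using that by (rule rtranclp_trans)
    show "\<exists>T. openin (top_of_set C) T \<and> a \<in> T \<and> (\<forall>x\<in>T. seg\<^sup>*\<^sup>* a x)" if "a \<in> C" for a
    proof -
      have "a \<in> ?E"
        using that CE by blast
      from nearby_joined_by_two_segments[OF this]
      obtain U where U: "open U" "a \<in> U" "\<forall>b \<in> U \<inter> ?E. \<exists>c. seg a c \<and> seg c b"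
        unfolding seg_def by blast
      have "\<forall>x\<in>C \<inter> U. seg\<^sup>*\<^sup>* a x"
      proof
        fix x assume "x \<in> C \<inter> U"
        then obtain c where "seg a c" "seg c x"
          using U(3) CE by blast
        then show "seg\<^sup>*\<^sup>* a x"
          by (rule converse_rtranclp_into_rtranclp[OF _ r_into_rtranclp])
      qed
      then show ?thesis
        using U that by (intro exI[of _ "C \<inter> U"]) (auto simp: openin_open_Int)
    qed
  qed
  then show ?thesis
    unfolding seg_def using assms(4) CE by (intro polygonal_path_if_segment_chain) auto
qed

end
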